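(* Let $n$ be a positive integer and let $G$ be a group (not assumed finite) which is an $n$-BFC-group and has trivial centre. Then $$|G|\leq n^{64(\log n)^5}.$$ In particular, $|G|$ is bounded by a function of $n$.
   Context: A group $G$ is called an $n$-BFC-group if each of its conjugacy classes is finite and contains at most $n$ elements. The symbol $\log$ denotes the logarithm to base $2$. *)

theory Defs
  imports Complex_Main "HOL-Algebra.Group"
begin

definition group_center :: "('a, 'b) monoid_scheme \<Rightarrow> 'a set" where
  "group_center G = {z \<in> carrier G. \<forall>g \<in> carrier G. z \<otimes>\<^bsub>G\<^esub> g = g \<otimes>\<^bsub>G\<^esub> z}"

definition conjugacy_class :: "('a, 'b) monoid_scheme \<Rightarrow> 'a \<Rightarrow> 'a set" where
  "conjugacy_class G x = {g \<otimes>\<^bsub>G\<^esub> x \<otimes>\<^bsub>G\<^esub> inv\<^bsub>G\<^esub> g | g. g \<in> carrier G}"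

(* The finiteness clause is needed: card of an infinite set is 0. *)
definition BFC_group :: "nat \<Rightarrow> ('a, 'b) monoid_scheme \<Rightarrow> bool" where
  "BFC_group n G \<longleftrightarrow> group G \<and>
     (\<forall>x \<in> carrier G. finite (conjugacy_class G x) \<and> card (conjugacy_class G x) \<le> n)"

end

theory Submission
  imports Defs "HOL-Algebra.Generated_Groups"
begin

text \<open>
  If finitely many elements have trivial common centralizer, then the group embeds as a set into
  the product of their conjugacy classes: a group element is determined by how it conjugates them.
  If every class has at most \<open>n\<close> elements and \<open>d\<close> elements have trivial common centralizer, then \<open>|G| \<le> n\<^sup>d\<close>. So the task is to find such
  elements, with \<open>d\<close> of the order of \<open>(log n)\<^sup>2\<close>.

  Let \<open>a\<close> be an element whose class \<open>Y\<close> has the largest size. An averaging argument gives a set \<open>F\<close>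
  of at most \<open>2m\<close> elements, where \<open>n \<le> 2\<^sup>m\<close>, generating a subgroup that is transitive on \<open>Y\<close> by
  conjugation. Let \<open>D\<close> be the centralizer of \<open>F \<union> {a}\<close>. Every element of \<open>Y\<close> is a conjugate of \<open>a\<close>
  by a product of elements of \<open>F\<close> and their inverses, so \<open>D\<close> centralizes \<open>Y\<close>. For \<open>c \<in> D\<close> the class
  of \<open>ca\<close> contains \<open>cY\<close>, hence equals \<open>cY\<close> by maximality of \<open>|Y|\<close>. Therefore conjugating \<open>c\<close> by any
  element of \<open>G\<close> multiplies it by a quotient of two elements of \<open>Y\<close>, which \<open>D\<close> centralizes
  (lemma \<open>conj_by_centralizer_element\<close>). In commutator notation this says \<open>[D, G, D] = 1\<close>, and
  the three subgroups lemma gives \<open>[D, D, G] = 1\<close>: commutators of elements of \<open>D\<close> are central,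
  hence trivial, and \<open>D\<close> is abelian (lemma \<open>abelian_if_commutators_centralize\<close>).

  Finally \<open>D\<close> has index at most \<open>n\<^sup>2\<^sup>m\<^sup>+\<^sup>1\<close>, and each element adjoined to a proper subgroup at least
  halves its index. So \<open>D\<close> together with a set \<open>X\<close> of at most \<open>m(2m + 1)\<close> elements generates \<open>G\<close>.
  An element of \<open>D\<close> that commutes with \<open>X\<close> also commutes with the abelian group \<open>D\<close>, so it is
  central and equals 1. Thus \<open>F \<union> {a} \<union> X\<close> has trivial centralizer and
  \<open>|G| \<le> n\<^sup>d\<close> with \<open>d = (2m + 1)(m + 1)\<close>. For \<open>m\<close> the least integer \<open>\<ge> log n\<close> this is at most
  \<open>15 (log n)\<^sup>2\<close> when \<open>n \<ge> 2\<close>.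
\<close>

definition centralizer :: "('a, 'b) monoid_scheme \<Rightarrow> 'a set \<Rightarrow> 'a set" where
  "centralizer G S = {x \<in> carrier G. \<forall>s \<in> S. x \<otimes>\<^bsub>G\<^esub> s = s \<otimes>\<^bsub>G\<^esub> x}"

context group
begin

definition conj_by :: "'a \<Rightarrow> 'a \<Rightarrow> 'a" where
  "conj_by g x = g \<otimes> x \<otimes> inv g"

section \<open>Conjugation and centralizers\<close>

lemma conj_by_closed [simp]:
  "g \<in> carrier G \<Longrightarrow> x \<in> carrier G \<Longrightarrow> conj_by g x \<in> carrier G"
  by (simp add: conj_by_def)

lemma conj_by_one [simp]: "x \<in> carrier G \<Longrightarrow> conj_by \<one> x = x"
  by (simp add: conj_by_def)

lemma conj_by_conj_by:
  assumes "g \<in> carrier G" "h \<in> carrier G" "x \<in> carrier G"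
  shows "conj_by g (conj_by h x) = conj_by (g \<otimes> h) x"
  using assms by (simp add: conj_by_def inv_mult_group m_assoc)

lemma conj_by_inv_cancel [simp]:
  assumes "g \<in> carrier G" "x \<in> carrier G"
  shows "conj_by (inv g) (conj_by g x) = x" "conj_by g (conj_by (inv g) x) = x"
  using assms by (simp_all add: conj_by_conj_by)

lemma conj_by_mult:
  assumes "g \<in> carrier G" "x \<in> carrier G" "y \<in> carrier G"
  shows "conj_by g (x \<otimes> y) = conj_by g x \<otimes> conj_by g y"
proof -
  have "inv g \<otimes> (g \<otimes> (y \<otimes> inv g)) = y \<otimes> inv g"
    using assms by (simp add: m_assoc [symmetric])
  then show ?thesis using assms by (simp add: conj_by_def m_assoc)
qed

lemma conj_by_inv:
  assumes "g \<in> carrier G" "x \<in> carrier G"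
  shows "conj_by g (inv x) = inv (conj_by g x)"
  using assms by (simp add: conj_by_def inv_mult_group m_assoc)

lemma conj_by_fixes_iff:
  assumes "g \<in> carrier G" "x \<in> carrier G"
  shows "conj_by g x = x \<longleftrightarrow> g \<otimes> x = x \<otimes> g"
  using assms unfolding conj_by_def by (metis inv_solve_right m_closed)

lemma conjugacy_class_eq: "conjugacy_class G x = (\<lambda>g. conj_by g x) ` carrier G"
  by (auto simp: conjugacy_class_def conj_by_def)

lemma conj_by_in_class [simp]: "g \<in> carrier G \<Longrightarrow> conj_by g x \<in> conjugacy_class G x"
  by (auto simp: conjugacy_class_eq)

lemma class_subset: "x \<in> carrier G \<Longrightarrow> conjugacy_class G x \<subseteq> carrier G"
  by (auto simp: conjugacy_class_eq)

lemma self_in_class: "x \<in> carrier G \<Longrightarrow> x \<in> conjugacy_class G x"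
  using conj_by_in_class [of \<one> x] by simp

lemma conj_by_class_closed:
  assumes "x \<in> carrier G" "g \<in> carrier G" "y \<in> conjugacy_class G x"
  shows "conj_by g y \<in> conjugacy_class G x"
  using assms by (auto simp: conjugacy_class_eq conj_by_conj_by)

lemma class_transitive:
  assumes "x \<in> carrier G" "y \<in> conjugacy_class G x" "z \<in> conjugacy_class G x"
  obtains g where "g \<in> carrier G" "conj_by g y = z"
proof -
  obtain h k where "h \<in> carrier G" "y = conj_by h x" "k \<in> carrier G" "z = conj_by k x"
    using assms by (auto simp: conjugacy_class_eq)
  then have "k \<otimes> inv h \<in> carrier G" "conj_by (k \<otimes> inv h) y = z"
    using assms(1) by (auto simp: conj_by_conj_by [symmetric])
  then show thesis by (rule that)
qed

lemma subgroup_centralizer: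
  assumes "S \<subseteq> carrier G"
  shows "subgroup (centralizer G S) G"
proof (rule subgroupI)
  show "centralizer G S \<subseteq> carrier G" "centralizer G S \<noteq> {}"
    using assms by (auto simp: centralizer_def intro!: exI [of _ \<one>])
next
  fix x assume "x \<in> centralizer G S"
  then have x: "x \<in> carrier G" and fix_x: "\<And>s. s \<in> S \<Longrightarrow> conj_by x s = s"
    using assms by (auto simp: centralizer_def conj_by_fixes_iff)
  have "inv x \<otimes> s = s \<otimes> inv x" if s: "s \<in> S" for s
  proof -
    have "conj_by (inv x) s = s"
      using conj_by_inv_cancel(1) [of x s] fix_x [OF s] x s assms by auto
    then show ?thesis using x s assms by (simp add: conj_by_fixes_iff subset_iff)
  qed
  then show "inv x \<in> centralizer G S" using x by (simp add: centralizer_def)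
next
  fix x y assume "x \<in> centralizer G S" "y \<in> centralizer G S"
  then show "x \<otimes> y \<in> centralizer G S"
    using assms unfolding centralizer_def by (auto simp: subset_iff) (metis m_assoc)
qed

lemma centralizer_generate:
  assumes "S \<subseteq> carrier G" "x \<in> centralizer G S"
  shows "x \<in> centralizer G (generate G S)"
proof -
  have x: "x \<in> carrier G" using assms by (simp add: centralizer_def)
  have "S \<subseteq> centralizer G {x}"
    using assms by (auto simp: centralizer_def)
  then have "generate G S \<subseteq> centralizer G {x}"
    by (rule generate_subgroup_incl) (use x in \<open>auto intro: subgroup_centralizer\<close>)
  then show ?thesis
    using x by (fastforce simp: centralizer_def)
qed

section \<open>Few elements acting transitively on a conjugacy class\<close>

text \<open>For a transitive action, a uniformly random permutation sends a given point to each point with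
  equal probability. So the expected number of points of \<open>U\<close> that stay in \<open>U\<close> is \<open>|U|\<^sup>2 / |Y|\<close>, and
  some group element does at least as well as the average.\<close>

lemma exists_conj_spreading:
  assumes a: "a \<in> carrier G" and fin: "finite (conjugacy_class G a)"
    and U: "U \<subseteq> conjugacy_class G a"
  obtains g where "g \<in> carrier G"
    "card {t \<in> U. conj_by g t \<in> U} * card (conjugacy_class G a) \<le> card U ^ 2"
proof -
  define Y where "Y = conjugacy_class G a"
  \<comment> \<open>The group may be infinite at this stage, so the average is taken over the finite set \<open>P\<close> of
    permutations of the class that it induces.\<close>
  define perm where "perm g = restrict (conj_by g) Y" for g
  define P where "P = perm ` carrier G"
  define N where "N t t' = {p \<in> P. p t = t'}" for t t'
  have Yc: "Y \<subseteq> carrier G" and finY: "finite Y" and UY: "U \<subseteq> Y"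
    using class_subset [OF a] fin U by (auto simp: Y_def)
  have finU: "finite U" using UY finY by (rule finite_subset)
  have Ycl: "conj_by g y \<in> Y" if "g \<in> carrier G" "y \<in> Y" for g y
    using that a conj_by_class_closed by (auto simp: Y_def)
  have P_maps: "p y \<in> Y" if "p \<in> P" "y \<in> Y" for p y
    using that Ycl by (auto simp: P_def perm_def)
  have finP: "finite P"
  proof (rule finite_subset)
    show "P \<subseteq> (\<Pi>\<^sub>E y\<in>Y. Y)" using Ycl by (auto simp: P_def perm_def)
    show "finite (\<Pi>\<^sub>E y\<in>Y. Y)" using finY by (simp add: finite_PiE)
  qed
  have N_le: "card (N t t') \<le> card (N s s')"
    if t: "t \<in> Y" "t' \<in> Y" and s: "s \<in> Y" "s' \<in> Y" for t t' s s'
  proof -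
    obtain r where r: "r \<in> carrier G" "conj_by r s = t"
      using class_transitive [OF a] s t unfolding Y_def by metis
    obtain q where q: "q \<in> carrier G" "conj_by q t' = s'"
      using class_transitive [OF a] s t unfolding Y_def by metis
    \<comment> \<open>Composing with \<open>r\<close> before and \<open>q\<close> after carries the permutations taking \<open>t\<close> to \<open>t'\<close>
      injectively to those taking \<open>s\<close> to \<open>s'\<close>.\<close>
    define f where "f p = (\<lambda>y\<in>Y. conj_by q (p (conj_by r y)))" for p :: "'a \<Rightarrow> 'a"
    have f_perm: "f (perm g) = perm (q \<otimes> g \<otimes> r)" if "g \<in> carrier G" for g
      using that q r Yc Ycl
      by (auto simp: f_def perm_def fun_eq_iff conj_by_conj_by subset_iff m_assoc)
    have "inj_on f P"
    proof (rule inj_onI)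
      fix p p' assume p: "p \<in> P" "p' \<in> P" and eq: "f p = f p'"
      have "p y = p' y" if y: "y \<in> Y" for y
      proof -
        have yr: "conj_by (inv r) y \<in> Y" using y r Ycl by simp
        have "conj_by q (p y) = conj_by q (p' y)"
          using fun_cong [OF eq, of "conj_by (inv r) y"] yr y r Yc
          by (simp add: f_def subset_iff)
        then show ?thesis
          using q P_maps [OF p(1) y] P_maps [OF p(2) y] Yc
          by (metis conj_by_inv_cancel(1) subsetD)
      qed
      moreover have "p \<in> extensional Y" "p' \<in> extensional Y"
        using p by (auto simp: P_def perm_def)
      ultimately show "p = p'" by (metis extensionalityI)
    qed
    then have "inj_on f (N t t')" by (rule inj_on_subset) (auto simp: N_def)
    moreover have "f ` N t t' \<subseteq> N s s'"
    proof
      fix z assume "z \<in> f ` N t t'"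
      then obtain g where g: "g \<in> carrier G" "perm g t = t'" "z = f (perm g)"
        by (auto simp: N_def P_def)
      then have "z \<in> P" using q r f_perm by (auto simp: P_def)
      moreover have "z s = s'" using g s r q by (simp add: f_def)
      ultimately show "z \<in> N s s'" by (simp add: N_def)
    qed
    moreover have "finite (N s s')" using finP by (simp add: N_def)
    ultimately show ?thesis by (rule card_inj_on_le)
  qed
  define k where "k = card (N a a)"
  have aY: "a \<in> Y" using self_in_class [OF a] by (simp add: Y_def)
  have Nk: "card (N t t') = k" if "t \<in> Y" "t' \<in> Y" for t t'
    unfolding k_def by (intro antisym N_le that aY)
  have cardP: "card P = card Y * k"
  proof -
    have "card P = (\<Sum>t'\<in>Y. card (N a t'))"
      using sum.group [of P Y "\<lambda>p. p a" "\<lambda>_. 1::nat"] P_maps aY finP finY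
      by (auto simp: N_def image_subset_iff)
    then show ?thesis using Nk aY by simp
  qed
  have "(\<Sum>p\<in>P. card {t \<in> U. p t \<in> U}) = (\<Sum>p\<in>P. \<Sum>t\<in>U. if p t \<in> U then 1 else 0)"
    using finU by (simp add: sum.If_cases Int_def)
  also have "\<dots> = (\<Sum>t\<in>U. \<Sum>p\<in>P. if p t \<in> U then 1 else 0)"
    by (rule sum.swap)
  also have "\<dots> = (\<Sum>t\<in>U. card {p \<in> P. p t \<in> U})"
    using finP by (simp add: sum.If_cases Int_def)
  also have "\<dots> = (\<Sum>t\<in>U. \<Sum>t'\<in>U. card (N t t'))"
  proof (rule sum.cong [OF refl])
    fix t assume "t \<in> U"
    have "{p \<in> {p \<in> P. p t \<in> U}. p t = t'} = N t t'" if "t' \<in> U" for t'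
      using that by (auto simp: N_def)
    then show "card {p \<in> P. p t \<in> U} = (\<Sum>t'\<in>U. card (N t t'))"
      using sum.group [of "{p \<in> P. p t \<in> U}" U "\<lambda>p. p t" "\<lambda>_. 1::nat"] finP finU
      by (auto simp: image_subset_iff)
  qed
  also have "\<dots> = (\<Sum>t\<in>U. \<Sum>t'\<in>U. k)"
    using UY by (intro sum.cong refl Nk) auto
  finally have total: "(\<Sum>p\<in>P. card {t \<in> U. p t \<in> U}) = card U ^ 2 * k"
    by (simp add: power2_eq_square)
  have "\<exists>p\<in>P. card {t \<in> U. p t \<in> U} * card Y \<le> card U ^ 2"
  proof (rule ccontr)
    assume "\<not> ?thesis"
    then have "\<And>p. p \<in> P \<Longrightarrow> card U ^ 2 < card {t \<in> U. p t \<in> U} * card Y" by auto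
    moreover have "P \<noteq> {}" by (auto simp: P_def)
    ultimately have "(\<Sum>p\<in>P. card U ^ 2) < (\<Sum>p\<in>P. card {t \<in> U. p t \<in> U} * card Y)"
      using finP by (intro sum_strict_mono) auto
    also have "\<dots> = card P * card U ^ 2"
      by (subst sum_distrib_right [symmetric]) (simp add: total cardP)
    finally show False by simp
  qed
  then obtain g where "g \<in> carrier G" "card {t \<in> U. perm g t \<in> U} * card Y \<le> card U ^ 2"
    by (auto simp: P_def)
  moreover have "{t \<in> U. perm g t \<in> U} = {t \<in> U. conj_by g t \<in> U}"
    using UY by (auto simp: perm_def)
  ultimately show thesis by (intro that) (auto simp: Y_def)
qed

text \<open>Adjoining the element of \<open>exists_conj_spreading\<close> squares the proportion of the class that the
  generated subgroup does not reach from \<open>a\<close>. With no element adjoined, only \<open>a\<close> itself is reached,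
  so the proportion starts at \<open>1 - 1/|Y|\<close>.\<close>

lemma unreached_shrinks:
  assumes a: "a \<in> carrier G" and fin: "finite (conjugacy_class G a)"
  shows "\<exists>F. finite F \<and> F \<subseteq> carrier G \<and> card F \<le> j \<and>
    real (card (conjugacy_class G a - (\<lambda>h. conj_by h a) ` generate G F))
      \<le> real (card (conjugacy_class G a)) * (1 - 1 / real (card (conjugacy_class G a))) ^ (2 ^ j)"
proof (induction j)
  case 0
  have "card (conjugacy_class G a - {a}) = card (conjugacy_class G a) - 1"
    using self_in_class [OF a] fin by simp
  moreover have "card (conjugacy_class G a) > 0"
    using self_in_class [OF a] fin by (auto simp: card_gt_0_iff)
  ultimately have "real (card (conjugacy_class G a - {a}))
      \<le> real (card (conjugacy_class G a)) * (1 - 1 / real (card (conjugacy_class G a)))"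
    by (simp add: field_simps of_nat_diff)
  then show ?case using a by (intro exI [of _ "{}"]) (simp add: generate_empty)
next
  case (Suc j)
  define Y where "Y = conjugacy_class G a"
  define orb where "orb F = (\<lambda>h. conj_by h a) ` generate G F" for F
  define m where "m = real (card Y)"
  obtain F where F: "finite F" "F \<subseteq> carrier G" "card F \<le> j"
    and le: "real (card (Y - orb F)) \<le> m * (1 - 1 / m) ^ (2 ^ j)"
    using Suc by (auto simp: Y_def m_def orb_def)
  have m: "m > 0" using self_in_class [OF a] fin by (auto simp: m_def Y_def card_gt_0_iff)
  obtain g where g: "g \<in> carrier G"
    and gle: "card {t \<in> Y - orb F. conj_by g t \<in> Y - orb F} * card Y \<le> card (Y - orb F) ^ 2"
    using exists_conj_spreading [OF a fin, of "Y - orb F"] by (auto simp: Y_def)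
  have F': "insert g F \<subseteq> carrier G" using F g by simp
  have mono: "generate G F \<subseteq> generate G (insert g F)" by (intro mono_generate) auto
  \<comment> \<open>A point that \<open>g\<close> moves into the old orbit is reached once \<open>g\<close> is available.\<close>
  have "Y - orb (insert g F) \<subseteq> {t \<in> Y - orb F. conj_by g t \<in> Y - orb F}"
  proof
    fix t assume t: "t \<in> Y - orb (insert g F)"
    then have tc: "t \<in> carrier G" using class_subset [OF a] by (auto simp: Y_def)
    have "conj_by g t \<notin> orb F"
    proof
      assume "conj_by g t \<in> orb F"
      then obtain h where h: "h \<in> generate G F" "conj_by g t = conj_by h a"
        by (auto simp: orb_def)
      have hc: "h \<in> carrier G" using h F generate_in_carrier by blast
      have "t = conj_by (inv g \<otimes> h) a"
        using conj_by_inv_cancel(1) [OF g tc] h g hc a by (simp add: conj_by_conj_by)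
      moreover have "inv g \<otimes> h \<in> generate G (insert g F)"
        using h mono by (intro generate.eng generate.inv) auto
      ultimately show False using t by (auto simp: orb_def)
    qed
    then show "t \<in> {t \<in> Y - orb F. conj_by g t \<in> Y - orb F}"
      using t mono g a conj_by_class_closed by (auto simp: orb_def Y_def)
  qed
  then have "card (Y - orb (insert g F)) \<le> card {t \<in> Y - orb F. conj_by g t \<in> Y - orb F}"
    by (rule card_mono [rotated]) (use fin in \<open>simp add: Y_def\<close>)
  then have "card (Y - orb (insert g F)) * card Y \<le> card (Y - orb F) ^ 2"
    using gle by (meson le_trans mult_le_mono1)
  then have "real (card (Y - orb (insert g F))) * m \<le> real (card (Y - orb F)) ^ 2"
    unfolding m_def by (metis of_nat_le_iff of_nat_mult of_nat_power)
  also have "\<dots> \<le> (m * (1 - 1 / m) ^ (2 ^ j)) ^ 2"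
    by (intro power_mono le) auto
  also have "\<dots> = (m * (1 - 1 / m) ^ (2 ^ Suc j)) * m"
    by (simp add: power2_eq_square power_mult_distrib power_mult [symmetric] power_add [symmetric] mult_2)
  finally have "real (card (Y - orb (insert g F))) \<le> m * (1 - 1 / m) ^ (2 ^ Suc j)"
    using m by (metis mult_le_cancel_right_pos)
  moreover have "card (insert g F) \<le> Suc j"
    using F card_insert_le_m1 [of "Suc j" F g] by simp
  ultimately show ?case using F F' unfolding Y_def m_def orb_def
    by (intro exI [of _ "insert g F"]) auto
qed

text \<open>After \<open>2m\<close> steps the unreached part of a class of size \<open>c \<le> 2\<^sup>m\<close> has at most
  \<open>c q\<close> elements, where \<open>q\<close> is the \<open>c\<^sup>2\<close>-th power of \<open>1 - 1/c\<close>. Since \<open>q \<le> exp (-c)\<close>, this is less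
  than 1.\<close>

lemma few_elements_transitive:
  assumes a: "a \<in> carrier G" and fin: "finite (conjugacy_class G a)"
    and card: "card (conjugacy_class G a) \<le> 2 ^ m"
  obtains F where "finite F" "F \<subseteq> carrier G" "card F \<le> 2 * m"
    "conjugacy_class G a = (\<lambda>h. conj_by h a) ` generate G F"
proof -
  define c where "c = card (conjugacy_class G a)"
  have c: "c > 0" using self_in_class [OF a] fin by (auto simp: c_def card_gt_0_iff)
  obtain F where F: "finite F" "F \<subseteq> carrier G" "card F \<le> 2 * m"
    and le: "real (card (conjugacy_class G a - (\<lambda>h. conj_by h a) ` generate G F))
      \<le> real c * (1 - 1 / real c) ^ (2 ^ (2 * m))"
    using unreached_shrinks [OF a fin, of "2 * m"] by (auto simp: c_def)
  have "c * c \<le> 2 ^ (2 * m)"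
    using card by (simp add: c_def mult_2 power_add mult_le_mono)
  then have "(1 - 1 / real c) ^ (2 ^ (2 * m)) \<le> (1 - 1 / real c) ^ (c * c)"
    using c by (intro power_decreasing) auto
  also have "\<dots> \<le> exp (- 1 / real c) ^ (c * c)"
    using c exp_ge_add_one_self [of "- 1 / real c"] by (intro power_mono) auto
  also have "\<dots> = exp (- real c)"
    using c by (simp add: exp_of_nat_mult [symmetric])
  finally have "real c * (1 - 1 / real c) ^ (2 ^ (2 * m)) \<le> real c * exp (- real c)"
    by (intro mult_left_mono) auto
  also have "\<dots> < 1"
  proof -
    have "real c < exp (real c)" using exp_ge_add_one_self [of "real c"] by linarith
    then show ?thesis by (simp add: exp_minus field_simps)
  qed
  finally have "card (conjugacy_class G a - (\<lambda>h. conj_by h a) ` generate G F) = 0"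
    using le by linarith
  then have "conjugacy_class G a \<subseteq> (\<lambda>h. conj_by h a) ` generate G F"
    using fin by auto
  moreover have "(\<lambda>h. conj_by h a) ` generate G F \<subseteq> conjugacy_class G a"
    using F generate_in_carrier by (auto simp: conjugacy_class_eq)
  ultimately show thesis using F by (intro that [of F]) auto
qed

section \<open>An abelian subgroup that is a centralizer of few elements\<close>

text \<open>Elements of \<open>generate G F\<close> fix \<open>c\<close> and move \<open>a\<close> through its whole class, so the class of
  \<open>c \<otimes> a\<close> contains a translate of the class of \<open>a\<close>; it has no room for anything else.\<close>

lemma class_mult_eq:
  assumes a: "a \<in> carrier G" and F: "F \<subseteq> carrier G"
    and trans: "conjugacy_class G a = (\<lambda>h. conj_by h a) ` generate G F"
    and c: "c \<in> centralizer G F"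
    and fin: "finite (conjugacy_class G (c \<otimes> a))"
    and max: "card (conjugacy_class G (c \<otimes> a)) \<le> card (conjugacy_class G a)"
  shows "conjugacy_class G (c \<otimes> a) = (\<lambda>y. c \<otimes> y) ` conjugacy_class G a"
proof -
  have cc: "c \<in> carrier G" using c by (simp add: centralizer_def)
  have "(\<lambda>y. c \<otimes> y) ` conjugacy_class G a \<subseteq> conjugacy_class G (c \<otimes> a)"
  proof clarify
    fix y assume "y \<in> conjugacy_class G a"
    then obtain h where h: "h \<in> generate G F" "y = conj_by h a" using trans by auto
    have hc: "h \<in> carrier G" using h F generate_in_carrier by blast
    have "conj_by h c = c"
      using centralizer_generate [OF F c] h hc cc by (auto simp: conj_by_fixes_iff centralizer_def)
    then have "c \<otimes> y = conj_by h (c \<otimes> a)" using h hc cc a by (simp add: conj_by_mult)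
    then show "c \<otimes> y \<in> conjugacy_class G (c \<otimes> a)" using hc by simp
  qed
  moreover have "card ((\<lambda>y. c \<otimes> y) ` conjugacy_class G a) = card (conjugacy_class G a)"
    using class_subset [OF a] cc by (intro card_image inj_onI) (auto simp: subset_iff)
  ultimately show ?thesis using fin max by (metis card_seteq)
qed

text \<open>Conjugating \<open>c \<otimes> a\<close> by \<open>g\<close> gives \<open>c \<otimes> y\<close> for some \<open>y\<close> in the class of \<open>a\<close>. Hence the commutator
  \<open>u\<close> of \<open>c\<close> and \<open>g\<close> is a quotient of two members of that class, and the centralizer of
  \<open>insert a F\<close> centralizes the class because \<open>F\<close> generates a transitive group.\<close>

lemma conj_by_centralizer_element:
  assumes a: "a \<in> carrier G" and F: "F \<subseteq> carrier G"
    and trans: "conjugacy_class G a = (\<lambda>h. conj_by h a) ` generate G F"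
    and fin: "\<And>x. x \<in> carrier G \<Longrightarrow> finite (conjugacy_class G x)"
    and max: "\<And>x. x \<in> carrier G \<Longrightarrow> card (conjugacy_class G x) \<le> card (conjugacy_class G a)"
    and c: "c \<in> centralizer G (insert a F)" and g: "g \<in> carrier G"
  obtains u where "u \<in> centralizer G (centralizer G (insert a F))" "conj_by g c = c \<otimes> u"
proof -
  let ?D = "centralizer G (insert a F)"
  have aF: "insert a F \<subseteq> carrier G" using a F by simp
  have cc: "c \<in> carrier G" using c by (simp add: centralizer_def)
  have Ycent: "conjugacy_class G a \<subseteq> centralizer G ?D"
  proof
    fix y assume y: "y \<in> conjugacy_class G a"
    then obtain h where h: "h \<in> generate G F" "y = conj_by h a" using trans by auto
    have "generate G F \<subseteq> generate G (insert a F)" by (intro mono_generate) auto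
    then have h': "h \<in> generate G (insert a F)" using h by auto
    have "a \<in> generate G (insert a F)" by (intro generate.incl) auto
    moreover have "inv h \<in> generate G (insert a F)"
      by (rule generate_m_inv_closed [OF aF h'])
    ultimately have "y \<in> generate G (insert a F)"
      unfolding h(2) conj_by_def using h' by (intro generate.eng)
    moreover have "y \<in> carrier G" using y class_subset [OF a] by auto
    moreover have "y \<otimes> d = d \<otimes> y" if "y \<in> generate G (insert a F)" "d \<in> ?D" for d
      using centralizer_generate [OF aF that(2)] that(1)
      unfolding centralizer_def [of G "generate G (insert a F)"] by auto
    ultimately show "y \<in> centralizer G ?D"
      unfolding centralizer_def [of G ?D] by blast
  qed
  have "conj_by g (c \<otimes> a) \<in> (\<lambda>y. c \<otimes> y) ` conjugacy_class G a"
  proof -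
    have "c \<in> centralizer G F" using c by (simp add: centralizer_def)
    then have "conjugacy_class G (c \<otimes> a) = (\<lambda>y. c \<otimes> y) ` conjugacy_class G a"
      using cc a by (intro class_mult_eq [OF a F trans] fin max) auto
    then show ?thesis using conj_by_in_class [OF g] by blast
  qed
  then obtain y where y: "y \<in> conjugacy_class G a" "conj_by g c \<otimes> conj_by g a = c \<otimes> y"
    using g cc a by (auto simp: conj_by_mult)
  have sub: "subgroup (centralizer G ?D) G"
    by (rule subgroup_centralizer) (auto simp: centralizer_def)
  have "y \<in> centralizer G ?D" "conj_by g a \<in> centralizer G ?D"
    using Ycent y(1) conj_by_in_class [OF g] by blast+
  then have "y \<otimes> inv (conj_by g a) \<in> centralizer G ?D"
    by (intro subgroup.m_closed [OF sub] subgroup.m_inv_closed [OF sub])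
  moreover have "conj_by g c = c \<otimes> (y \<otimes> inv (conj_by g a))"
  proof -
    have yc: "y \<in> carrier G" using y(1) class_subset [OF a] by auto
    have "conj_by g c = conj_by g c \<otimes> conj_by g a \<otimes> inv (conj_by g a)"
      using g cc a by (simp add: m_assoc)
    also have "\<dots> = c \<otimes> y \<otimes> inv (conj_by g a)" by (simp only: y(2))
    finally show ?thesis using yc g cc a by (simp add: m_assoc)
  qed
  ultimately show thesis by (rule that)
qed

text \<open>This is the three subgroups lemma in the case \<open>[D, G, D] = 1\<close>. Replacing one entry of a
  commutator of elements of \<open>D\<close> by a conjugate does not change the commutator. So conjugating both
  entries by \<open>g\<close> has the same effect as conjugating neither, and the commutator is central.\<close>

lemma abelian_if_commutators_centralize:
  assumes triv: "group_center G = {\<one>}"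
    and D: "D \<subseteq> carrier G"
    and comm: "\<And>c g. c \<in> D \<Longrightarrow> g \<in> carrier G \<Longrightarrow> \<exists>u \<in> centralizer G D. conj_by g c = c \<otimes> u"
    and c: "c \<in> D" and d: "d \<in> D"
  shows "c \<otimes> d = d \<otimes> c"
proof -
  have cc: "c \<in> carrier G" and dc: "d \<in> carrier G" using c d D by auto
  define k where "k x y = x \<otimes> y \<otimes> inv x \<otimes> inv y" for x y
  have kc: "k x y \<in> carrier G" if "x \<in> carrier G" "y \<in> carrier G" for x y
    using that by (simp add: k_def)
  have k_conj: "conj_by g (k x y) = k (conj_by g x) (conj_by g y)"
    if "g \<in> carrier G" "x \<in> carrier G" "y \<in> carrier G" for g x y
    using that by (simp add: k_def conj_by_mult conj_by_inv)
  have k_left: "k (conj_by g c) d = k c d" if g: "g \<in> carrier G" for g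
  proof -
    obtain u where u: "u \<in> carrier G" "u \<otimes> d = d \<otimes> u" "conj_by g c = c \<otimes> u"
      using comm [OF c g] d by (auto simp: centralizer_def)
    have "u \<otimes> d \<otimes> inv u = d" using u dc by (metis inv_solve_right m_closed)
    moreover have "k (c \<otimes> u) d = c \<otimes> (u \<otimes> d \<otimes> inv u) \<otimes> inv c \<otimes> inv d"
    proof -
      have "u \<otimes> (inv u \<otimes> (inv c \<otimes> inv d)) = inv c \<otimes> inv d"
        using u cc dc by (simp add: m_assoc [symmetric])
      then show ?thesis using u cc dc by (simp add: k_def inv_mult_group m_assoc)
    qed
    ultimately show ?thesis by (simp add: u k_def)
  qed
  have k_right: "k c (conj_by g d) = k c d" if g: "g \<in> carrier G" for g
  proof -
    obtain u where u: "u \<in> carrier G" "u \<otimes> c = c \<otimes> u" "conj_by g d = d \<otimes> u"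
      using comm [OF d g] c by (auto simp: centralizer_def)
    have "u \<otimes> inv c \<otimes> inv u = inv c"
      using u cc by (metis conj_by_def conj_by_fixes_iff conj_by_inv)
    moreover have "k c (d \<otimes> u) = c \<otimes> d \<otimes> (u \<otimes> inv c \<otimes> inv u) \<otimes> inv d"
      using u cc dc by (simp add: k_def inv_mult_group m_assoc)
    ultimately show ?thesis by (simp add: u k_def)
  qed
  \<comment> \<open>Conjugate \<open>c\<close> by the inverse of \<open>g\<close> first, so that conjugation by \<open>g\<close> then acts on \<open>d\<close> only.\<close>
  have "conj_by g (k c d) = k c d" if g: "g \<in> carrier G" for g
  proof -
    have "conj_by g (k c d) = conj_by g (k (conj_by (inv g) c) d)"
      using k_left [of "inv g"] g by simp
    also have "\<dots> = k c (conj_by g d)" using g cc dc by (simp add: k_conj)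
    finally show ?thesis using k_right [OF g] by simp
  qed
  then have "k c d \<in> group_center G"
    using kc [OF cc dc] by (auto simp: group_center_def conj_by_fixes_iff)
  then have "c \<otimes> d \<otimes> inv c \<otimes> inv d = \<one>" using triv by (simp add: k_def)
  then show ?thesis using cc dc
    by (metis inv_closed inv_solve_right l_one m_closed one_closed)
qed

section \<open>Counting by conjugates of a tuple\<close>

text \<open>The fibres of the map sending \<open>x\<close> to the tuple of conjugates of \<open>F\<close> by \<open>x\<close> are the left cosets
  of the centralizer of \<open>F\<close>. Counting tuples therefore replaces counting cosets below.\<close>

lemma conj_tuple_eq_iff:
  assumes F: "F \<subseteq> carrier G" and x: "x \<in> carrier G" and y: "y \<in> carrier G"
  shows "(\<lambda>f\<in>F. conj_by x f) = (\<lambda>f\<in>F. conj_by y f) \<longleftrightarrow> inv y \<otimes> x \<in> centralizer G F"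
proof -
  have "conj_by x f = conj_by y f \<longleftrightarrow> conj_by (inv y \<otimes> x) f = f" if "f \<in> carrier G" for f
    using that x y by (metis conj_by_closed conj_by_conj_by conj_by_inv_cancel inv_closed)
  then have "(\<forall>f\<in>F. conj_by x f = conj_by y f) \<longleftrightarrow> (\<forall>f\<in>F. conj_by (inv y \<otimes> x) f = f)"
    using F by blast
  also have "\<dots> \<longleftrightarrow> inv y \<otimes> x \<in> centralizer G F"
    using F x y by (auto simp: centralizer_def conj_by_fixes_iff subset_iff)
  finally show ?thesis by (auto simp: restrict_def fun_eq_iff)
qed

lemma card_conj_tuples:
  assumes F: "F \<subseteq> carrier G" "finite F"
    and fin: "\<And>x. x \<in> carrier G \<Longrightarrow> finite (conjugacy_class G x)"
    and le: "\<And>x. x \<in> carrier G \<Longrightarrow> card (conjugacy_class G x) \<le> n"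
    and A: "A \<subseteq> carrier G"
  shows "finite ((\<lambda>x. \<lambda>f\<in>F. conj_by x f) ` A)"
    and "card ((\<lambda>x. \<lambda>f\<in>F. conj_by x f) ` A) \<le> n ^ card F"
proof -
  have sub: "(\<lambda>x. \<lambda>f\<in>F. conj_by x f) ` A \<subseteq> (\<Pi>\<^sub>E f\<in>F. conjugacy_class G f)"
    using A by (auto simp: subset_iff)
  have finE: "finite (\<Pi>\<^sub>E f\<in>F. conjugacy_class G f)"
    using F fin by (intro finite_PiE) auto
  show "finite ((\<lambda>x. \<lambda>f\<in>F. conj_by x f) ` A)" using sub finE by (rule finite_subset)
  have "card ((\<lambda>x. \<lambda>f\<in>F. conj_by x f) ` A) \<le> card (\<Pi>\<^sub>E f\<in>F. conjugacy_class G f)"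
    using finE sub by (rule card_mono)
  also have "\<dots> = (\<Prod>f\<in>F. card (conjugacy_class G f))" using F by (simp add: card_PiE)
  also have "\<dots> \<le> (\<Prod>f\<in>F. n)" using F le by (intro prod_mono) auto
  finally show "card ((\<lambda>x. \<lambda>f\<in>F. conj_by x f) ` A) \<le> n ^ card F" by simp
qed

text \<open>The centralizer of \<open>F\<close> has index at most \<open>n ^ card F\<close>, and adjoining an element outside a
  subgroup at least doubles the number of its cosets that are covered. So a set of adjoined elements
  of maximal size, subject to this doubling, must generate everything.\<close>

lemma centralizer_few_generators:
  assumes F: "F \<subseteq> carrier G" "finite F"
    and fin: "\<And>x. x \<in> carrier G \<Longrightarrow> finite (conjugacy_class G x)"
    and le: "\<And>x. x \<in> carrier G \<Longrightarrow> card (conjugacy_class G x) \<le> n"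
  obtains X where "finite X" "X \<subseteq> carrier G" "2 ^ card X \<le> n ^ card F"
    "generate G (centralizer G F \<union> X) = carrier G"
proof -
  define tup where "tup x = (\<lambda>f\<in>F. conj_by x f)" for x
  define H where "H X = generate G (centralizer G F \<union> X)" for X
  define good where "good X \<longleftrightarrow> finite X \<and> X \<subseteq> carrier G \<and> 2 ^ card X \<le> card (tup ` H X)" for X
  have Hc: "H X \<subseteq> carrier G" if "X \<subseteq> carrier G" for X
    using that generate_incl [of "centralizer G F \<union> X"] by (auto simp: H_def centralizer_def)
  have Hsub: "subgroup (H X) G" if "X \<subseteq> carrier G" for X
    unfolding H_def using that by (intro generate_is_subgroup) (auto simp: centralizer_def)
  have fin_tup: "finite (tup ` H X)" and le_tup: "card (tup ` H X) \<le> n ^ card F"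
    if "X \<subseteq> carrier G" for X
    using card_conj_tuples [OF F fin le Hc [OF that]] by (auto simp: tup_def [abs_def])
  have "good {}"
    using fin_tup [of "{}"] generate.one [of G "centralizer G F \<union> {}"]
    by (auto simp: good_def H_def Suc_le_eq card_gt_0_iff)
  moreover have "card X < Suc (n ^ card F)" if "good X" for X
  proof -
    have "card X < 2 ^ card X" by (rule less_exp)
    moreover have "2 ^ card X \<le> card (tup ` H X)" "card (tup ` H X) \<le> n ^ card F"
      using that le_tup by (auto simp: good_def)
    ultimately show ?thesis by linarith
  qed
  ultimately obtain X where X: "good X" and maxX: "\<And>X'. good X' \<Longrightarrow> card X' \<le> card X"
    using ex_has_greatest_nat [of good "{}" card "Suc (n ^ card F)"] by (metis less_imp_le)
  have Xc: "X \<subseteq> carrier G" and Xf: "finite X" using X by (auto simp: good_def)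
  have "H X = carrier G"
  proof (rule ccontr)
    assume "H X \<noteq> carrier G"
    then obtain x where x: "x \<in> carrier G" "x \<notin> H X" using Hc [OF Xc] by auto
    have X'c: "insert x X \<subseteq> carrier G" using Xc x by simp
    \<comment> \<open>The tuples coming from the coset of \<open>x\<close>. They are as many as those of \<open>H X\<close> and disjoint
      from them, since \<open>H X\<close> is a union of fibres.\<close>
    let ?T = "(\<lambda>t. \<lambda>f\<in>F. conj_by x (t f)) ` tup ` H X"
    have T: "?T = (\<lambda>h. tup (x \<otimes> h)) ` H X"
      using x F Hc [OF Xc] by (auto simp: image_image tup_def fun_eq_iff conj_by_conj_by subset_iff
          intro!: image_cong)
    have inj: "inj_on (\<lambda>t. \<lambda>f\<in>F. conj_by x (t f)) (tup ` H X)"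
    proof (rule inj_onI, clarify)
      fix h k assume h: "h \<in> H X" "k \<in> H X"
        and eq: "(\<lambda>f\<in>F. conj_by x (tup h f)) = (\<lambda>f\<in>F. conj_by x (tup k f))"
      have "conj_by h f = conj_by k f" if f: "f \<in> F" for f
      proof -
        have "conj_by x (conj_by h f) = conj_by x (conj_by k f)"
          using fun_cong [OF eq, of f] f by (simp add: tup_def)
        then show ?thesis using x f h F Hc [OF Xc]
          by (metis conj_by_closed conj_by_inv_cancel(1) subsetD)
      qed
      then show "tup h = tup k" by (auto simp: tup_def)
    qed
    have disj: "tup ` H X \<inter> ?T = {}"
    proof (rule ccontr)
      assume "tup ` H X \<inter> ?T \<noteq> {}"
      then obtain h k where h: "h \<in> H X" "k \<in> H X" "tup (x \<otimes> h) = tup k"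
        unfolding T by fastforce
      have hc: "h \<in> carrier G" "k \<in> carrier G" using h Hc [OF Xc] by auto
      have "inv k \<otimes> (x \<otimes> h) \<in> centralizer G F"
        using conj_tuple_eq_iff [OF F(1), of "x \<otimes> h" k] h x hc by (simp add: tup_def)
      then have "inv k \<otimes> (x \<otimes> h) \<in> H X" unfolding H_def by (intro generate.incl) auto
      then have "k \<otimes> (inv k \<otimes> (x \<otimes> h)) \<otimes> inv h \<in> H X"
        by (rule subgroup.m_closed [OF Hsub [OF Xc] subgroup.m_closed [OF Hsub [OF Xc] h(2)]
            subgroup.m_inv_closed [OF Hsub [OF Xc] h(1)]])
      moreover have "k \<otimes> (inv k \<otimes> (x \<otimes> h)) \<otimes> inv h = x"
        using x hc by (simp add: m_assoc [symmetric]) (simp add: m_assoc)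
      ultimately show False using x by simp
    qed
    have mono: "H X \<subseteq> H (insert x X)" unfolding H_def by (intro mono_generate) auto
    have xH: "x \<in> H (insert x X)" unfolding H_def by (intro generate.incl) auto
    have "tup ` H X \<union> ?T \<subseteq> tup ` H (insert x X)"
      unfolding T using mono xH Hsub [OF X'c] by (auto intro!: imageI subgroup.m_closed)
    then have "card (tup ` H X \<union> ?T) \<le> card (tup ` H (insert x X))"
      by (rule card_mono [OF fin_tup [OF X'c]])
    moreover have "card (tup ` H X \<union> ?T) = 2 * card (tup ` H X)"
      using disj fin_tup [OF Xc] by (simp add: card_Un_disjoint card_image [OF inj])
    moreover have "x \<notin> X" using x unfolding H_def by (auto intro: generate.incl)
    ultimately have "good (insert x X)"
      using X X'c by (auto simp: good_def)
    then show False using maxX [of "insert x X"] Xf \<open>x \<notin> X\<close> by simp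
  qed
  then show thesis using that [of X] X le_tup [of X] by (auto simp: good_def H_def)
qed

lemma card_le_if_centralizer_trivial:
  assumes F: "F \<subseteq> carrier G" "finite F" and triv: "centralizer G F = {\<one>}"
    and fin: "\<And>x. x \<in> carrier G \<Longrightarrow> finite (conjugacy_class G x)"
    and le: "\<And>x. x \<in> carrier G \<Longrightarrow> card (conjugacy_class G x) \<le> n"
  shows "finite (carrier G) \<and> card (carrier G) \<le> n ^ card F"
proof -
  have inj: "inj_on (\<lambda>x. \<lambda>f\<in>F. conj_by x f) (carrier G)"
  proof (rule inj_onI)
    fix x y assume "x \<in> carrier G" "y \<in> carrier G" "(\<lambda>f\<in>F. conj_by x f) = (\<lambda>f\<in>F. conj_by y f)"
    then show "x = y"
      using conj_tuple_eq_iff [OF F(1), of x y] triv inv_equality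
      by (metis inv_closed inv_inv inv_comm singletonD)
  qed
  then show ?thesis
    using card_conj_tuples [OF F fin le order_refl] card_image [OF inj] finite_image_iff [OF inj]
    by simp
qed

text \<open>The set with trivial centralizer consists of \<open>a\<close>, of at most \<open>2m\<close> elements making \<open>D\<close> abelian, and of at
  most \<open>m(2m + 1)\<close> elements generating the group together with \<open>D\<close>.\<close>

lemma card_le_if_BFC_centreless:
  assumes bfc: "BFC_group n G" and triv: "group_center G = {\<one>}" and nm: "n \<le> 2 ^ m"
  shows "finite (carrier G) \<and> card (carrier G) \<le> n ^ ((2 * m + 1) * (m + 1))"
proof -
  have fin: "finite (conjugacy_class G x)" and le: "card (conjugacy_class G x) \<le> n"
    if "x \<in> carrier G" for x
    using bfc that by (auto simp: BFC_group_def)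
  have n: "n > 0"
    using le [OF one_closed] fin [OF one_closed] self_in_class [OF one_closed]
    by (metis card_gt_0_iff empty_iff less_le_trans)
  obtain a where a: "a \<in> carrier G"
    and max: "\<And>x. x \<in> carrier G \<Longrightarrow> card (conjugacy_class G x) \<le> card (conjugacy_class G a)"
    using ex_has_greatest_nat [of "\<lambda>x. x \<in> carrier G" \<one> "\<lambda>x. card (conjugacy_class G x)" "Suc n"] le
    by (auto simp: less_Suc_eq_le)
  obtain F where F: "finite F" "F \<subseteq> carrier G" "card F \<le> 2 * m"
    and trans: "conjugacy_class G a = (\<lambda>h. conj_by h a) ` generate G F"
    using few_elements_transitive [OF a fin [OF a]] le [OF a] nm le_trans by metis
  let ?S = "insert a F"
  let ?D = "centralizer G ?S"
  have S: "?S \<subseteq> carrier G" "finite ?S" using a F by auto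
  have Dc: "?D \<subseteq> carrier G" by (auto simp: centralizer_def)
  have cardS: "card ?S \<le> 2 * m + 1"
    using F card_insert_le_m1 [of "2 * m + 1" F a] by simp
  have abel: "c \<otimes> d = d \<otimes> c" if "c \<in> ?D" "d \<in> ?D" for c d
    using triv Dc _ that
  proof (rule abelian_if_commutators_centralize)
    fix c g assume "c \<in> ?D" "g \<in> carrier G"
    then show "\<exists>u \<in> centralizer G ?D. conj_by g c = c \<otimes> u"
      using conj_by_centralizer_element [OF a F(2) trans fin max] by metis
  qed
  obtain X where X: "finite X" "X \<subseteq> carrier G" "2 ^ card X \<le> n ^ card ?S"
    "generate G (?D \<union> X) = carrier G"
    using centralizer_few_generators [OF S fin le] by metis
  have "centralizer G (?S \<union> X) = {\<one>}"
  proof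
    show "{\<one>} \<subseteq> centralizer G (?S \<union> X)" using S X by (auto simp: centralizer_def)
    show "centralizer G (?S \<union> X) \<subseteq> {\<one>}"
    proof
      fix x assume x: "x \<in> centralizer G (?S \<union> X)"
      then have "x \<in> carrier G" "x \<in> ?D" and xX: "\<forall>s\<in>X. x \<otimes> s = s \<otimes> x"
        by (auto simp: centralizer_def)
      moreover have "\<forall>d\<in>?D. x \<otimes> d = d \<otimes> x" using abel [OF \<open>x \<in> ?D\<close>] by blast
      ultimately have "x \<in> centralizer G (?D \<union> X)"
        unfolding centralizer_def [of G "?D \<union> X"] by blast
      then have "x \<in> centralizer G (carrier G)"
        using centralizer_generate [of "?D \<union> X" x] X Dc by auto
      then have "x \<in> group_center G" by (auto simp: centralizer_def group_center_def)
      then show "x \<in> {\<one>}" using triv by simp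
    qed
  qed
  then have main: "finite (carrier G) \<and> card (carrier G) \<le> n ^ card (?S \<union> X)"
    using S X fin le by (intro card_le_if_centralizer_trivial) auto
  have "(2::nat) ^ card X \<le> n ^ (2 * m + 1)"
    using X(3) power_increasing [OF cardS, of n] n by linarith
  also have "\<dots> \<le> (2 ^ m) ^ (2 * m + 1)" by (intro power_mono nm) auto
  also have "\<dots> = 2 ^ (m * (2 * m + 1))" by (rule power_mult [symmetric])
  finally have "card X \<le> m * (2 * m + 1)" by (rule power_le_imp_le_exp [rotated]) simp
  then have "card (?S \<union> X) \<le> (2 * m + 1) * (m + 1)"
    using card_Un_le [of ?S X] cardS by (simp add: algebra_simps)
  then have "n ^ card (?S \<union> X) \<le> n ^ ((2 * m + 1) * (m + 1))"
    using n by (intro power_increasing) auto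
  then show ?thesis using main by linarith
qed

end

section \<open>The bound in terms of the logarithm\<close>

lemma exponent_bound:
  assumes n: "n > 0"
  obtains m where "n \<le> 2 ^ m"
    "real (n ^ ((2 * m + 1) * (m + 1))) \<le> real n powr (64 * (log 2 (real n)) ^ 5)"
proof (cases "n = 1")
  case True
  then show thesis using that [of 0] by simp
next
  case False
  define L where "L = log 2 (real n)"
  define m where "m = nat \<lceil>L\<rceil>"
  have L1: "L \<ge> 1" using False n by (simp add: L_def le_log_iff)
  have m_ge: "L \<le> real m" and m_le: "real m \<le> 2 * L" using L1 by (auto simp: m_def) linarith+
  have "real n = 2 powr L" using n by (simp add: L_def)
  also have "\<dots> \<le> 2 ^ m" using m_ge by (simp add: powr_realpow [symmetric])
  finally have "real n \<le> real (2 ^ m)" by simp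
  then have nm: "n \<le> 2 ^ m" by (simp only: of_nat_le_iff)
  have "real ((2 * m + 1) * (m + 1)) = (2 * real m + 1) * (real m + 1)"
    by (simp add: algebra_simps)
  also have "\<dots> \<le> (5 * L) * (3 * L)"
    using m_le L1 by (intro mult_mono) auto
  also have "\<dots> = 15 * L ^ 2" by (simp add: power2_eq_square)
  also have "\<dots> \<le> 64 * L ^ 5"
    using L1 power_increasing [of 2 5 L] by (intro mult_mono) auto
  finally have "real n powr real ((2 * m + 1) * (m + 1)) \<le> real n powr (64 * L ^ 5)"
    using n by (intro powr_mono) auto
  then have "real (n ^ ((2 * m + 1) * (m + 1))) \<le> real n powr (64 * L ^ 5)"
    using n by (simp only: of_nat_power powr_realpow of_nat_0_less_iff)
  then show thesis using that nm by (simp add: L_def)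
qed

theorem theorem1:
  shows "(\<forall>(n::nat) (G :: ('a, 'b) monoid_scheme).
            n > 0 \<and> BFC_group n G \<and> group_center G = {\<one>\<^bsub>G\<^esub>} \<longrightarrow>
              finite (carrier G) \<and>
              real (card (carrier G)) \<le> real n powr (64 * (log 2 (real n)) ^ 5)) \<and>
         (\<exists>f :: nat \<Rightarrow> nat. \<forall>(n::nat) (G :: ('a, 'b) monoid_scheme).
            n > 0 \<and> BFC_group n G \<and> group_center G = {\<one>\<^bsub>G\<^esub>} \<longrightarrow>
              finite (carrier G) \<and> card (carrier G) \<le> f n)"
proof -
  have bound: "finite (carrier G) \<and>
      real (card (carrier G)) \<le> real n powr (64 * (log 2 (real n)) ^ 5)"
    if n: "n > 0" and G: "BFC_group n G" "group_center G = {\<one>\<^bsub>G\<^esub>}"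
    for n :: nat and G :: "('a, 'b) monoid_scheme"
  proof -
    interpret group G using G by (simp add: BFC_group_def)
    obtain m where m: "n \<le> 2 ^ m"
      "real (n ^ ((2 * m + 1) * (m + 1))) \<le> real n powr (64 * (log 2 (real n)) ^ 5)"
      using exponent_bound [OF n] .
    have "finite (carrier G) \<and> card (carrier G) \<le> n ^ ((2 * m + 1) * (m + 1))"
      by (rule card_le_if_BFC_centreless [OF G m(1)])
    then show ?thesis using m(2) by (metis of_nat_le_iff order_trans)
  qed
  show ?thesis
  proof (intro conjI)
    show "\<exists>f :: nat \<Rightarrow> nat. \<forall>(n::nat) (G :: ('a, 'b) monoid_scheme).
            n > 0 \<and> BFC_group n G \<and> group_center G = {\<one>\<^bsub>G\<^esub>} \<longrightarrow>
              finite (carrier G) \<and> card (carrier G) \<le> f n"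
    proof (intro exI allI impI, elim conjE)
      fix n :: nat and G :: "('a, 'b) monoid_scheme"
      assume "n > 0" "BFC_group n G" "group_center G = {\<one>\<^bsub>G\<^esub>}"
      then show "finite (carrier G) \<and>
          card (carrier G) \<le> nat \<lfloor>real n powr (64 * (log 2 (real n)) ^ 5)\<rfloor>"
        using bound [of n G] le_nat_floor by blast
    qed
  qed (use bound in blast)
qed

end
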